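(* Let $G$ be a connected unicycle graph of order $n$ with $l(G)$ leaves and $s(G)$ support vertices. Then $$\gamma_{o}(G)\geq\frac{n-l(G)+s(G)}{3}.$$
   Context: All graphs $G=(V,E)$ are finite and simple; the order of $G$ is $n=|V|$. A unicycle graph is a graph that contains exactly one cycle. For $v\in V$, $N(v)=\{u\in V: uv\in E\}$ is the open neighborhood and $N[v]=N(v)\cup\{v\}$ the closed neighborhood; the degree of $v$ is $|N(v)|$. A leaf is a vertex of degree one, and a support vertex is a vertex adjacent to at least one leaf. $l(G)$ and $s(G)$ denote the numbers of leaves and of support vertices of $G$, respectively. A set $S\subseteq V$ is a dominating set if every vertex of $V-S$ has at least one neighbor in $S$. A global offensive alliance of $G$ is a dominating set $S$ such that $|N[v]\cap S|\geq|N[v]-S|$ for every $v\in V-S$. The global offensive alliance number $\gamma_{o}(G)$ is the minimum cardinality of a global offensive alliance of $G$. *)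

theory Defs
  imports Complex_Main "Graph_Theory.Graph_Theory"
begin

text \<open>
  Finite simple graphs are represented by the locale \<^locale>\<open>pair_graph\<close>: an edge \<open>uv\<close> is the
  pair of arcs \<open>(u, v)\<close> and \<open>(v, u)\<close>.
\<close>

definition nbhd :: "'a pair_pre_digraph \<Rightarrow> 'a \<Rightarrow> 'a set" where
  "nbhd G v = {u \<in> pverts G. (u, v) \<in> parcs G}"

definition closed_nbhd :: "'a pair_pre_digraph \<Rightarrow> 'a \<Rightarrow> 'a set" where
  "closed_nbhd G v = insert v (nbhd G v)"

definition leaves :: "'a pair_pre_digraph \<Rightarrow> 'a set" where
  "leaves G = {v \<in> pverts G. card (nbhd G v) = 1}"

definition supports :: "'a pair_pre_digraph \<Rightarrow> 'a set" where
  "supports G = {v \<in> pverts G. \<exists>u \<in> leaves G. u \<in> nbhd G v}"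

text \<open>
  The library's \<open>cycle\<close> counts the closed walk \<open>u, v, u\<close> along a single edge as a cycle, so cycles
  of a simple graph are those of length at least 3. The walk also carries a starting point and a
  direction; the cycle as a subgraph is identified by its set of undirected edges.
\<close>

definition cycle_edge_sets :: "'a pair_pre_digraph \<Rightarrow> 'a set set set" where
  "cycle_edge_sets G =
     {(\<lambda>(u, v). {u, v}) ` set p | p. pre_digraph.cycle (with_proj G) p \<and> 3 \<le> length p}"

definition unicycle :: "'a pair_pre_digraph \<Rightarrow> bool" where
  "unicycle G \<longleftrightarrow> (\<exists>!C. C \<in> cycle_edge_sets G)"

definition dominating :: "'a pair_pre_digraph \<Rightarrow> 'a set \<Rightarrow> bool" where
  "dominating G S \<longleftrightarrow> S \<subseteq> pverts G \<and> (\<forall>v \<in> pverts G - S. nbhd G v \<inter> S \<noteq> {})"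

definition global_offensive_alliance :: "'a pair_pre_digraph \<Rightarrow> 'a set \<Rightarrow> bool" where
  "global_offensive_alliance G S \<longleftrightarrow> dominating G S \<and>
     (\<forall>v \<in> pverts G - S. card (closed_nbhd G v \<inter> S) \<ge> card (closed_nbhd G v - S))"

definition goa_number :: "'a pair_pre_digraph \<Rightarrow> nat" where
  "goa_number G = Min (card ` {S. global_offensive_alliance G S})"

text \<open>The minimum is taken over a finite nonempty set.\<close>

lemma global_offensive_alliance_pverts: "global_offensive_alliance G (pverts G)"
  by (simp add: global_offensive_alliance_def dominating_def)

lemma (in pair_graph) finite_global_offensive_alliances:
  "finite {S. global_offensive_alliance G S}"
  by (rule finite_subset[of _ "Pow (pverts G)"])
     (auto simp: global_offensive_alliance_def dominating_def pair_finite_verts)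

end

theory Submission
  imports Defs
begin

text \<open>
  Let \<open>S\<close> be a global offensive alliance and \<open>D\<close> its complement. Every vertex of \<open>D\<close> that is not a
  leaf has at least two neighbours in \<open>S\<close>, and every leaf in \<open>D\<close> has one. A unicycle graph has at
  most \<open>n = |S| + |D|\<close> edges, so counting the edges between \<open>S\<close> and \<open>D\<close> gives
  \<open>2 |D| - |leaves in D| \<le> |S| + |D|\<close>. On the other hand a support vertex outside \<open>S\<close> has all its
  leaves in \<open>S\<close>, whence \<open>s \<le> |S| + |leaves in S|\<close>. The sum of these two inequalities is the claim.
\<close>

section \<open>Cycles and edge counts in finite symmetric relations\<close>

text \<open>The list names each vertex of the cycle once; appending \<open>hd xs\<close> supplies
  the closing arc. A bare relation is used so that arcs and vertices can be deleted freely.\<close>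

definition cyclic_path :: "'a rel \<Rightarrow> 'a list \<Rightarrow> bool" where
  "cyclic_path E xs \<longleftrightarrow>
     distinct xs \<and> 3 \<le> length xs \<and> set (vwalk_arcs (xs @ [hd xs])) \<subseteq> E"

lemma cyclic_path_mono: "cyclic_path E xs \<Longrightarrow> E \<subseteq> F \<Longrightarrow> cyclic_path F xs"
  by (auto simp: cyclic_path_def)

text \<open>On a longest path every neighbour of the first vertex lies on the path. A neighbour
  other than the second vertex closes a cycle.\<close>

lemma cyclic_path_if_min_degree_two:
  assumes "finite V" "V \<noteq> {}" "E \<subseteq> V \<times> V" "sym E" "irrefl E"
    and deg: "\<And>v u. v \<in> V \<Longrightarrow> \<exists>w. (v, w) \<in> E \<and> w \<noteq> u"
  shows "\<exists>xs. cyclic_path E xs"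
proof -
  define P where "P xs \<longleftrightarrow> xs \<noteq> [] \<and> distinct xs \<and> set xs \<subseteq> V \<and> set (vwalk_arcs xs) \<subseteq> E" for xs
  obtain v where "v \<in> V" using assms(2) by blast
  then have "P [v]" by (simp add: P_def)
  moreover have "length xs < Suc (card V)" if "P xs" for xs
    using that card_mono[OF assms(1), of "set xs"] by (auto simp: P_def distinct_card)
  ultimately obtain xs where xs: "P xs" and max: "\<And>ys. P ys \<Longrightarrow> length ys \<le> length xs"
    using ex_has_greatest_nat[of P "[v]" length "Suc (card V)"] by (metis less_imp_le)
  then obtain x ys where xs_eq: "xs = x # ys" by (cases xs) (auto simp: P_def)
  with xs have "x \<in> V" by (simp add: P_def)
  have closed: "w \<in> set xs" if "(x, w) \<in> E" for w
  proof (rule ccontr)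
    assume "w \<notin> set xs"
    moreover have "w \<in> V" "(w, x) \<in> E" using that assms(3,4) by (auto dest: symD)
    ultimately have "P (w # xs)" using xs by (simp add: P_def xs_eq)
    then show False using max by fastforce
  qed
  obtain y zs where ys_eq: "ys = y # zs"
    using deg[OF \<open>x \<in> V\<close>, of x] closed by (cases ys) (auto simp: xs_eq)
  obtain w where w: "(x, w) \<in> E" "w \<noteq> y" using deg[OF \<open>x \<in> V\<close>] by blast
  then have "w \<noteq> x" using \<open>irrefl E\<close> by (auto simp: irrefl_def)
  then have "w \<in> set zs" using closed[OF w(1)] w(2) by (simp add: xs_eq ys_eq)
  then obtain as bs where "zs = as @ w # bs" by (meson split_list)
  \<comment> \<open>The cycle is the initial segment ending at \<open>w\<close>, closed by the arc
    from \<open>w\<close> to \<open>x\<close>; \<open>w\<close> differs from \<open>y\<close>, so it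
    has at least three vertices.\<close>
  then have split: "xs = (x # y # as @ [w]) @ bs" by (simp add: xs_eq ys_eq)
  have "set (vwalk_arcs (x # y # as @ [w])) \<subseteq> E"
    using xs set_vwalk_arcs_append1[of "x # y # as @ [w]" bs] unfolding P_def split by blast
  moreover have "(w, x) \<in> E" using w(1) \<open>sym E\<close> by (auto dest: symD)
  ultimately have "cyclic_path E (x # y # as @ [w])"
    using xs set_vwalk_arcs_snoc[of "x # y # as @ [w]" x] by (auto simp: cyclic_path_def P_def split)
  then show ?thesis ..
qed

lemma card_2_le: "card {a, b} \<le> 2"
  by (simp add: card_insert_if)

text \<open>Each edge counts as two arcs, so this is the forest bound of at most
  \<open>card V - 1\<close> edges. The induction deletes a vertex of degree at most one.\<close>

lemma card_arcs_if_acyclic: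
  assumes "finite V" "V \<noteq> {}" "E \<subseteq> V \<times> V" "sym E" "irrefl E" "\<nexists>xs. cyclic_path E xs"
  shows "card E + 2 \<le> 2 * card V"
  using assms
proof (induction "card V" arbitrary: V E rule: less_induct)
  case less
  \<comment> \<open>The degree hypothesis of the previous lemma must fail: \<open>u\<close> is the
    only possible neighbour of \<open>v\<close>, and is arbitrary if \<open>v\<close> is
    isolated.\<close>
  obtain v u where v: "v \<in> V" and u: "\<And>w. (v, w) \<in> E \<Longrightarrow> w = u"
    using cyclic_path_if_min_degree_two[OF less.prems(1-5)] less.prems(6) by blast
  have u': "w = u" if "(w, v) \<in> E" for w using u that \<open>sym E\<close> by (auto dest: symD)
  show ?case
  proof (cases "V = {v}")
    case True
    then have "E = {}" using less.prems(3,5) by (auto simp: irrefl_def)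
    then show ?thesis using True by simp
  next
    case False
    define V' where "V' = V - {v}"
    define E' where "E' = E \<inter> V' \<times> V'"
    have "finite V'" "V' \<noteq> {}" "E' \<subseteq> V' \<times> V'" "sym E'" "irrefl E'"
      using False v less.prems by (auto simp: V'_def E'_def sym_def irrefl_def)
    moreover have card_V: "card V = Suc (card V')"
      using v less.prems(1) unfolding V'_def by (metis card_Suc_Diff1)
    moreover have "\<nexists>xs. cyclic_path E' xs"
      using less.prems(6) cyclic_path_mono[of E' _ E] by (auto simp: E'_def)
    ultimately have IH: "card E' + 2 \<le> 2 * card V'" using less.hyps[of V' E'] by simp
    have "E \<subseteq> E' \<union> {(v, u), (u, v)}" using less.prems(3) u u' by (auto simp: E'_def V'_def)
    moreover have "finite E'"
      using finite_subset[OF \<open>E' \<subseteq> V' \<times> V'\<close>] \<open>finite V'\<close> by blast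
    ultimately have "card E \<le> card (E' \<union> {(v, u), (u, v)})" by (intro card_mono) blast+
    moreover have "card (E' \<union> {(v, u), (u, v)}) \<le> card E' + card {(v, u), (u, v)}"
      by (rule card_Un_le)
    moreover have "card {(v, u), (u, v)} \<le> 2" by (rule card_2_le)
    ultimately show ?thesis using IH card_V by linarith
  qed
qed

section \<open>Edge count of a unicycle graph\<close>

context pair_graph
begin

lemma vwalk_arcs_cas: "pcas u (vwalk_arcs (u # xs)) (last (u # xs))"
  by (induction xs arbitrary: u) auto

lemma awalk_verts_vwalk_arcs: "pawalk_verts u (vwalk_arcs (u # xs)) = u # xs"
  by (induction xs arbitrary: u) auto

text \<open>Bridge from vertex lists to the arc-list cycles that occur in
  \<open>cycle_edge_sets\<close>.\<close>

lemma cycle_if_cyclic_path: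
  assumes "cyclic_path (parcs G) xs"
  shows "cycle (vwalk_arcs (xs @ [hd xs]))" "3 \<le> length (vwalk_arcs (xs @ [hd xs]))"
proof -
  obtain x ys where xs: "xs = x # ys" using assms by (cases xs) (auto simp: cyclic_path_def)
  define p where "p = vwalk_arcs (xs @ [hd xs])"
  have p: "p = vwalk_arcs (x # ys @ [x])" by (simp add: p_def xs)
  have len: "length p = length xs"
    using vwalk_length_simp[of "xs @ [hd xs]"] unfolding vwalk_length_def p_def by simp
  then show "3 \<le> length p" using assms by (simp add: cyclic_path_def)
  have "set p \<subseteq> parcs G" using assms by (simp add: cyclic_path_def p_def)
  moreover have "p \<noteq> []" "hd p \<in> set p" "fst (hd p) = x"
    using len xs p by (cases ys; auto)+
  ultimately have "x \<in> pverts G" using arc_fst_in_verts by blast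
  moreover have "pcas x p x" using vwalk_arcs_cas[of x "ys @ [x]"] by (simp add: p)
  moreover have "pawalk_verts x p = x # ys @ [x]"
    using awalk_verts_vwalk_arcs[of x "ys @ [x]"] by (simp add: p)
  moreover have "distinct (ys @ [x])" using assms by (auto simp: cyclic_path_def xs)
  ultimately show "cycle p"
    using \<open>set p \<subseteq> parcs G\<close> \<open>p \<noteq> []\<close> unfolding cycle_def awalk_def by auto
qed

text \<open>Deleting one edge of the unique cycle leaves an acyclic graph, to which the forest bound
  applies; the deleted edge gives back two arcs.\<close>

lemma card_arcs_if_unicycle:
  assumes "unicycle G"
  shows "card (parcs G) \<le> 2 * card (pverts G)"
proof -
  let ?edges = "\<lambda>p. (\<lambda>(u, v). {u, v}) ` set p"
  obtain C where "C \<in> cycle_edge_sets G"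
    and C_unique: "\<And>C'. C' \<in> cycle_edge_sets G \<Longrightarrow> C' = C"
    using assms unfolding unicycle_def by blast
  then obtain p where p: "cycle p" and "C = ?edges p" unfolding cycle_edge_sets_def by blast
  with C_unique have unique: "?edges q = ?edges p" if "cycle q" "3 \<le> length q" for q
    using that unfolding cycle_edge_sets_def by blast
  have "p \<noteq> []" using p by (auto simp: cycle_def)
  then obtain a b where ab: "(a, b) \<in> set p" by (metis list.set_sel(1) surj_pair)
  have "set p \<subseteq> parcs G" using p by (auto simp: cycle_def awalk_def)
  with ab have ab_arc: "(a, b) \<in> parcs G" by blast
  define E where "E = parcs G - {(a, b), (b, a)}"
  have acyclic: "\<nexists>xs. cyclic_path E xs"
  proof
    assume "\<exists>xs. cyclic_path E xs"
    then obtain xs where xs: "cyclic_path E xs" ..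
    let ?q = "vwalk_arcs (xs @ [hd xs])"
    have "cyclic_path (parcs G) xs" using cyclic_path_mono[OF xs] by (auto simp: E_def)
    \<comment> \<open>By uniqueness a surviving cycle would have the edges of \<open>p\<close>,
      hence use the deleted edge in one of its directions.\<close>
    then have "?edges ?q = ?edges p" using cycle_if_cyclic_path unique by blast
    moreover have "{a, b} \<in> ?edges p" using ab by force
    ultimately have "{a, b} \<in> ?edges ?q" by simp
    then have "(a, b) \<in> set ?q \<or> (b, a) \<in> set ?q" by (auto simp: doubleton_eq_iff)
    then show False using xs by (auto simp: cyclic_path_def E_def)
  qed
  have "sym E" "irrefl E" "E \<subseteq> pverts G \<times> pverts G" "pverts G \<noteq> {}"
    using ab_arc arcs_symmetric no_loops' wellformed' by (auto simp: E_def sym_def irrefl_def)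
  then have "card E + 2 \<le> 2 * card (pverts G)"
    using card_arcs_if_acyclic[OF pair_finite_verts _ _ _ _ acyclic] by blast
  moreover have "card (parcs G) \<le> card (E \<union> {(a, b), (b, a)})"
    using pair_finite_arcs by (intro card_mono) (auto simp: E_def)
  moreover have "card (E \<union> {(a, b), (b, a)}) \<le> card E + card {(a, b), (b, a)}"
    by (rule card_Un_le)
  moreover have "card {(a, b), (b, a)} \<le> 2" by (rule card_2_le)
  ultimately show ?thesis by linarith
qed

section \<open>Alliances, leaves and support vertices\<close>

lemma finite_nbhd: "finite (nbhd G v)"
  using pair_finite_verts by (simp add: nbhd_def)

lemma nbhd_sym: "v \<in> pverts G \<Longrightarrow> u \<in> nbhd G v \<Longrightarrow> v \<in> nbhd G u"
  using arcs_symmetric by (auto simp: nbhd_def)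

lemma leaf_nbhd_unique: "u \<in> leaves G \<Longrightarrow> v \<in> nbhd G u \<Longrightarrow> w \<in> nbhd G u \<Longrightarrow> v = w"
  by (auto simp: leaves_def card_1_singleton_iff)

text \<open>Since \<open>v\<close> itself counts among the vertices outside \<open>S\<close>, it has
  strictly more neighbours inside \<open>S\<close> than outside. With only one inside it would have
  none outside and be a leaf.\<close>

lemma two_nbrs_in_alliance:
  assumes S: "global_offensive_alliance G S" and v: "v \<in> pverts G - S" "v \<notin> leaves G"
  shows "2 \<le> card (nbhd G v \<inter> S)"
proof -
  have ne: "nbhd G v \<inter> S \<noteq> {}"
    and le: "card (closed_nbhd G v - S) \<le> card (closed_nbhd G v \<inter> S)"
    using assms by (auto simp: global_offensive_alliance_def dominating_def)
  have "v \<notin> nbhd G v" using no_loops' by (auto simp: nbhd_def)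
  then have "card (closed_nbhd G v - S) = Suc (card (nbhd G v - S))"
    using v(1) finite_nbhd by (simp add: closed_nbhd_def insert_Diff_if)
  moreover have "closed_nbhd G v \<inter> S = nbhd G v \<inter> S" using v(1) by (auto simp: closed_nbhd_def)
  ultimately have "Suc (card (nbhd G v - S)) \<le> card (nbhd G v \<inter> S)" using le by simp
  moreover have "card (nbhd G v) = card (nbhd G v - S) + card (nbhd G v \<inter> S)"
    using card_Int_Diff[OF finite_nbhd, of v S] by simp
  moreover have "card (nbhd G v) \<noteq> 1" using v by (simp add: leaves_def)
  moreover have "card (nbhd G v \<inter> S) \<noteq> 0" using ne finite_nbhd by simp
  ultimately show ?thesis by linarith
qed

lemma sum_nbrs_le_card_arcs:
  assumes "S \<subseteq> pverts G"
  shows "2 * (\<Sum>v \<in> pverts G - S. card (nbhd G v \<inter> S)) \<le> card (parcs G)"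
proof -
  let ?A = "SIGMA v : pverts G - S. nbhd G v \<inter> S"
  have fin: "finite ?A" using finite_nbhd pair_finite_verts by auto
  have sum: "card ?A = (\<Sum>v \<in> pverts G - S. card (nbhd G v \<inter> S))"
    using finite_nbhd pair_finite_verts by (simp add: card_SigmaI)
  have "card (?A \<union> prod.swap ` ?A) = card ?A + card (prod.swap ` ?A)"
    using fin by (intro card_Un_disjoint) auto
  moreover have "card (prod.swap ` ?A) = card ?A" by (simp add: card_image)
  moreover have "card (?A \<union> prod.swap ` ?A) \<le> card (parcs G)"
    using arcs_symmetric by (intro card_mono pair_finite_arcs) (auto simp: nbhd_def)
  ultimately show ?thesis using sum by simp
qed

text \<open>A leaf outside \<open>S\<close> is dominated only by its support vertex, so a support
  vertex outside \<open>S\<close> has its leaves in \<open>S\<close>. Choosing one leaf for each is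
  injective, as a leaf has a single neighbour.\<close>

lemma card_supports_le:
  assumes S: "global_offensive_alliance G S"
  shows "card (supports G) \<le> card S + card (leaves G \<inter> S)"
proof -
  have fin: "finite S" "finite (leaves G)"
    using S pair_finite_verts
    by (auto simp: global_offensive_alliance_def dominating_def leaves_def intro: finite_subset)
  have "\<exists>u. u \<in> leaves G \<inter> S \<and> u \<in> nbhd G v" if asm: "v \<in> supports G - S" for v
  proof -
    obtain u where u: "u \<in> leaves G" "u \<in> nbhd G v" and v: "v \<in> pverts G"
      using asm by (auto simp: supports_def)
    have "u \<in> S"
    proof (rule ccontr)
      assume "u \<notin> S"
      then have "u \<in> pverts G - S" using u(1) by (simp add: leaves_def)
      then obtain w where "w \<in> nbhd G u" "w \<in> S"
        using S unfolding global_offensive_alliance_def dominating_def by blast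
      then show False using leaf_nbhd_unique[OF u(1) nbhd_sym[OF v u(2)]] asm by blast
    qed
    with u show ?thesis by blast
  qed
  then obtain f where f: "\<And>v. v \<in> supports G - S \<Longrightarrow> f v \<in> leaves G \<inter> S \<and> f v \<in> nbhd G v"
    by metis
  have "inj_on f (supports G - S)"
  proof (rule inj_onI)
    fix v w assume vw: "v \<in> supports G - S" "w \<in> supports G - S" "f v = f w"
    then have "v \<in> pverts G" "w \<in> pverts G" by (simp_all add: supports_def)
    then have "v \<in> nbhd G (f v)" "w \<in> nbhd G (f w)" using f vw(1,2) nbhd_sym by blast+
    then show "v = w" using leaf_nbhd_unique f[OF vw(1)] vw(3) by auto
  qed
  then have "card (supports G - S) \<le> card (leaves G \<inter> S)"
    using f fin by (intro card_inj_on_le) auto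
  moreover have "card (supports G) \<le> card (S \<union> (supports G - S))"
    using fin pair_finite_verts by (intro card_mono) (auto simp: supports_def)
  moreover have "card (S \<union> (supports G - S)) \<le> card S + card (supports G - S)" by (rule card_Un_le)
  ultimately show ?thesis by linarith
qed

text \<open>Moving the leaves to the right-hand side keeps the inequality free of subtraction on
  naturals.\<close>

lemma alliance_lower_bound:
  assumes S: "global_offensive_alliance G S" and "unicycle G"
  shows "card (pverts G) + card (supports G) \<le> 3 * card S + card (leaves G)"
proof -
  let ?D = "pverts G - S"
  have sub: "S \<subseteq> pverts G" using S by (simp add: global_offensive_alliance_def dominating_def)
  have fin: "finite ?D" "finite S" using pair_finite_verts sub by (auto intro: finite_subset)
  have one: "1 \<le> card (nbhd G v \<inter> S)" if "v \<in> ?D" for v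
    using S that finite_nbhd
    by (auto simp: global_offensive_alliance_def dominating_def Suc_le_eq card_gt_0_iff)
  have "2 * card ?D = (\<Sum>v \<in> ?D. 2)" by simp
  \<comment> \<open>The indicator makes up for leaves, for which domination guarantees only one
    neighbour in \<open>S\<close>.\<close>
  also have "\<dots> \<le> (\<Sum>v \<in> ?D. card (nbhd G v \<inter> S) + (if v \<in> leaves G then 1 else 0))"
    using one two_nbrs_in_alliance[OF S] by (intro sum_mono) fastforce
  also have "\<dots> = (\<Sum>v \<in> ?D. card (nbhd G v \<inter> S)) + card (leaves G \<inter> ?D)"
    using fin by (simp add: sum.distrib sum.If_cases Int_commute)
  finally have "2 * card ?D \<le> card (pverts G) + card (leaves G \<inter> ?D)"
    using sum_nbrs_le_card_arcs[OF sub] card_arcs_if_unicycle[OF assms(2)] by linarith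
  moreover have "card (pverts G) = card S + card ?D"
    using card_Un_disjoint[of S ?D] fin sub by (simp add: Un_absorb1)
  moreover have "card (leaves G) = card (leaves G \<inter> S) + card (leaves G \<inter> ?D)"
  proof -
    have "finite (leaves G)" using pair_finite_verts by (simp add: leaves_def)
    moreover have "leaves G - S = leaves G \<inter> ?D" by (auto simp: leaves_def)
    ultimately show ?thesis using card_Int_Diff[of "leaves G" S] by simp
  qed
  ultimately show ?thesis using card_supports_le[OF S] by linarith
qed

end

theorem theorem3:
  fixes G :: "'a pair_pre_digraph"
  assumes "pair_graph G"
    and "Digraph_Component.connected (with_proj G)"
    and "unicycle G"
  shows "real (goa_number G) \<ge>
    (real (card (pverts G)) - real (card (leaves G)) + real (card (supports G))) / 3"
proof -
  interpret pair_graph G by fact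
  \<comment> \<open>The minimum is attained, so the bound for arbitrary alliances applies to
    it.\<close>
  have "goa_number G \<in> card ` {S. global_offensive_alliance G S}"
    unfolding goa_number_def
    using finite_global_offensive_alliances global_offensive_alliance_pverts
    by (intro Min_in) auto
  then obtain S where "global_offensive_alliance G S" "goa_number G = card S" by blast
  then have "card (pverts G) + card (supports G) \<le> 3 * goa_number G + card (leaves G)"
    using alliance_lower_bound assms(3) by simp
  then show ?thesis by simp
qed

end
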